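(* Let $q$ be a prime power and $V=\mathbb{F}_q^2$. Then $$\sigma_{\rm sep}(\mathbb{F}_q[V],\mathrm{O}_2^{+}(\mathbb{F}_q))=2.$$
   Context: For $\alpha\in\mathbb{F}_q^\times$ put $\sigma_\alpha=\begin{pmatrix}0&\alpha\\ \alpha^{-1}&0\end{pmatrix}$, $\tau_\alpha=\begin{pmatrix}\alpha&0\\0&\alpha^{-1}\end{pmatrix}$; then $\mathrm{O}_2^{+}(\mathbb{F}_q)=\{\sigma_\alpha,\tau_\alpha\mid\alpha\in\mathbb{F}_q^\times\}$, a subgroup of $\mathrm{GL}_2(\mathbb{F}_q)$, acting on $V=\mathbb{F}_q^2$. General definitions. Let $\mathcal V$ be an $n$-dimensional vector space over a field $\mathbb{F}$ with a fixed basis and $G$ a subgroup of $\mathrm{GL}(\mathcal V)$. $G$ acts diagonally on $\mathcal V^m=\mathcal V\oplus\cdots\oplus\mathcal V$ ($m$ times). The coordinate ring $\mathbb{F}[\mathcal V^m]$ is the polynomial ring in variables $x_{i,j}$ ($1\le i\le m$, $1\le j\le n$), where $x_{i,j}(\underline v)=v_i(j)$ is the $j$-th coordinate of $v_i$ for $\underline v=(v_1,\ldots,v_m)$. $G$ acts on $\mathbb{F}[\mathcal V^m]$ by algebra automorphisms extending $(g\cdot f)(\underline v)=f(g^{-1}\cdot\underline v)$ on linear forms, and $\mathbb{F}[\mathcal V^m]^G$ is the algebra of polynomials fixed by $G$. Elements $u,v\in\mathcal V^m$ are separated by a set $S\subset\mathbb{F}[\mathcal V^m]^G$ if there is $f\in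 S$ with $f(u)\ne f(v)$. A subset $S\subset\mathbb{F}[\mathcal V^m]^G$ is separating if any $u,v\in\mathcal V^m$ separated by $\mathbb{F}[\mathcal V^m]^G$ are separated by $S$. An $m_0$-tuple $\underline i=(i_1,\ldots,i_{m_0})$ of natural numbers is $m$-admissible if $1\le i_1<\cdots<i_{m_0}\le m$. For $f\in\mathbb{F}[\mathcal V^{m_0}]^G$ and $m$-admissible $\underline i$, $f^{(\underline i)}\in\mathbb{F}[\mathcal V^m]^G$ is the result of substituting $x_{k,j}\to x_{i_k,j}$ in $f$ for all $1\le k\le m_0$, $1\le j\le n$. For $S\subset\mathbb{F}[\mathcal V^{m_0}]^G$ its expansion is $S^{[m]}=\{f^{(\underline i)}\mid f\in S,\ \underline i\in\mathbb{N}^{m_0}\text{ is }m\text{-admissible}\}\subset\mathbb{F}[\mathcal V^m]^G$. $\sigma_{\rm sep}(\mathbb{F}[\mathcal V],G)$ denotes the minimal number $m_0\geq 1$ such that for some separating set $S$ for $\mathbb{F}[\mathcal V^{m_0}]^G$ the expansion $S^{[m]}$ is a separating set for $\mathbb{F}[\mathcal V^m]^G$ for all $m\ge m_0$. *)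

theory Defs
  imports
    "HOL-Analysis.Cartesian_Space"
    "HOL-Library.Poly_Mapping"
    "HOL-Library.FuncSet"
    "HOL-Number_Theory.Prime_Powers"
begin

section \<open>Multivariate polynomials\<close>

text \<open>
  Polynomials are formal, i.e. finitely supported maps from monomials to coefficients. Over a
  finite field they must not be confused with the functions they induce.
\<close>

type_synonym ('v, 'a) mpoly = "('v \<Rightarrow>\<^sub>0 nat) \<Rightarrow>\<^sub>0 'a"

definition Const :: "'a::zero \<Rightarrow> ('v, 'a) mpoly" where
  "Const c = Poly_Mapping.single 0 c"

definition Var :: "'v \<Rightarrow> ('v, 'a::zero_neq_one) mpoly" where
  "Var x = Poly_Mapping.single (Poly_Mapping.single x 1) 1"

definition vars :: "('v, 'a::zero) mpoly \<Rightarrow> 'v set" where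
  "vars p = (\<Union>t\<in>Poly_Mapping.keys p. Poly_Mapping.keys t)"

text \<open>
  The homomorphism that maps coefficients by \<open>c\<close> and sends each variable \<open>x\<close> to \<open>s x\<close>.
  It yields evaluation at a point for \<open>c = id\<close> and substitution of polynomials for
  \<open>c = Const\<close>.
\<close>

definition mpoly_hom ::
  "('a::zero \<Rightarrow> 'b::comm_semiring_1) \<Rightarrow> ('v \<Rightarrow> 'b) \<Rightarrow> ('v, 'a) mpoly \<Rightarrow> 'b" where
  "mpoly_hom c s p =
     (\<Sum>t\<in>Poly_Mapping.keys p.
        c (Poly_Mapping.lookup p t) *
        (\<Prod>x\<in>Poly_Mapping.keys t. s x ^ Poly_Mapping.lookup t x))"

definition mpoly_subst ::
  "('v \<Rightarrow> ('w, 'a::comm_semiring_1) mpoly) \<Rightarrow> ('v, 'a) mpoly \<Rightarrow> ('w, 'a) mpoly" where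
  "mpoly_subst = mpoly_hom Const"

lemma mpoly_hom_Const: "c 0 = 0 \<Longrightarrow> mpoly_hom c s (Const a) = c a"
  by (simp add: mpoly_hom_def Const_def)

lemma mpoly_hom_Var: "c 1 = 1 \<Longrightarrow> mpoly_hom c s (Var x) = s x"
  by (simp add: mpoly_hom_def Var_def)

lemma mpoly_subst_Var: "mpoly_subst s (Var x) = s x"
  by (simp add: mpoly_subst_def mpoly_hom_Var Const_def)


section \<open>Vector invariants\<close>

text \<open>
  Throughout, the vector space is \<open>'a ^ 'n\<close> with its standard basis, and a subgroup of its
  general linear group is a set \<open>G\<close> of matrices (that it is a subgroup is not part of the
  definitions; see \<open>O2plus_subgroup\<close> below). The pair \<open>(i, j)\<close> is the index of the variable
  \<open>x\<^sub>i\<^sub>,\<^sub>j\<close>.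
\<close>

definition vec_tuples :: "nat \<Rightarrow> (nat \<Rightarrow> 'a ^ 'n) set" where
  "vec_tuples m = {1..m} \<rightarrow>\<^sub>E UNIV"

definition coord_ring :: "nat \<Rightarrow> (nat \<times> 'n, 'a::field) mpoly set" where
  "coord_ring m = {f. vars f \<subseteq> {1..m} \<times> UNIV}"

definition eval_at :: "(nat \<Rightarrow> 'a ^ 'n) \<Rightarrow> (nat \<times> 'n, 'a::field) mpoly \<Rightarrow> 'a" where
  "eval_at v = mpoly_hom id (\<lambda>(i, j). v i $ j)"

text \<open>
  The linear form \<open>v \<mapsto> x\<^sub>i\<^sub>,\<^sub>j (g\<inverse> v)\<close> is the \<open>j\<close>-th entry of \<open>g\<inverse> v\<^sub>i\<close>, i.e. the
  combination of the \<open>x\<^sub>i\<^sub>,\<^sub>k\<close> whose coefficients form the \<open>j\<close>-th row of \<open>g\<inverse>\<close>.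
\<close>

definition poly_act ::
  "'a::field ^ 'n ^ 'n \<Rightarrow> (nat \<times> 'n, 'a) mpoly \<Rightarrow> (nat \<times> 'n, 'a) mpoly" where
  "poly_act g =
     mpoly_subst (\<lambda>(i, j). \<Sum>k\<in>UNIV. Const (matrix_inv g $ j $ k) * Var (i, k))"

lemma poly_act_Var:
  "poly_act g (Var (i, j)) = (\<Sum>k\<in>UNIV. Const (matrix_inv g $ j $ k) * Var (i, k))"
  by (simp add: poly_act_def mpoly_subst_Var)

definition invariants ::
  "('a::field ^ 'n ^ 'n) set \<Rightarrow> nat \<Rightarrow> (nat \<times> 'n, 'a) mpoly set" where
  "invariants G m = {f \<in> coord_ring m. \<forall>g\<in>G. poly_act g f = f}"

definition separated_by ::
  "(nat \<times> 'n, 'a::field) mpoly set \<Rightarrow> (nat \<Rightarrow> 'a ^ 'n) \<Rightarrow> (nat \<Rightarrow> 'a ^ 'n) \<Rightarrow> bool" where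
  "separated_by S u v \<longleftrightarrow> (\<exists>f\<in>S. eval_at u f \<noteq> eval_at v f)"

definition separating ::
  "('a::field ^ 'n ^ 'n) set \<Rightarrow> nat \<Rightarrow> (nat \<times> 'n, 'a) mpoly set \<Rightarrow> bool" where
  "separating G m S \<longleftrightarrow>
     S \<subseteq> invariants G m \<and>
     (\<forall>u\<in>vec_tuples m. \<forall>v\<in>vec_tuples m.
        separated_by (invariants G m) u v \<longrightarrow> separated_by S u v)"

text \<open>
  An \<open>m\<^sub>0\<close>-tuple of natural numbers is a function on \<^term>\<open>{1..m\<^sub>0::nat}\<close>.
\<close>

definition admissible :: "nat \<Rightarrow> nat \<Rightarrow> (nat \<Rightarrow> nat) set" where
  "admissible m\<^sub>0 m =
     {\<iota> \<in> {1..m\<^sub>0} \<rightarrow>\<^sub>E {1..m}. strict_mono_on {1..m\<^sub>0} \<iota>}"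

definition reindex ::
  "(nat \<Rightarrow> nat) \<Rightarrow> (nat \<times> 'n, 'a::field) mpoly \<Rightarrow> (nat \<times> 'n, 'a) mpoly" where
  "reindex \<iota> = mpoly_subst (\<lambda>(k, j). Var (\<iota> k, j))"

definition expansion ::
  "nat \<Rightarrow> nat \<Rightarrow> (nat \<times> 'n, 'a::field) mpoly set \<Rightarrow> (nat \<times> 'n, 'a) mpoly set" where
  "expansion m\<^sub>0 m S = {reindex \<iota> f | \<iota> f. f \<in> S \<and> \<iota> \<in> admissible m\<^sub>0 m}"

definition sigma_sep :: "('a::field ^ 'n ^ 'n) set \<Rightarrow> nat" where
  "sigma_sep G =
     (LEAST m\<^sub>0. m\<^sub>0 \<ge> 1 \<and>
        (\<exists>S. separating G m\<^sub>0 S \<and> (\<forall>m\<ge>m\<^sub>0. separating G m (expansion m\<^sub>0 m S))))"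


section \<open>The orthogonal group of plus type in dimension two\<close>

definition sigma_mat :: "'a::field \<Rightarrow> 'a ^ 2 ^ 2" where
  "sigma_mat \<alpha> = vector [vector [0, \<alpha>], vector [inverse \<alpha>, 0]]"

definition tau_mat :: "'a::field \<Rightarrow> 'a ^ 2 ^ 2" where
  "tau_mat \<alpha> = vector [vector [\<alpha>, 0], vector [0, inverse \<alpha>]]"

definition O2plus :: "('a::field ^ 2 ^ 2) set" where
  "O2plus = {sigma_mat \<alpha> | \<alpha>. \<alpha> \<noteq> 0} \<union> {tau_mat \<alpha> | \<alpha>. \<alpha> \<noteq> 0}"

lemma sigma_tau_mult:
  fixes \<alpha> \<beta> :: "'a::field"
  assumes "\<alpha> \<noteq> 0" "\<beta> \<noteq> 0"
  shows "sigma_mat \<alpha> ** sigma_mat \<beta> = tau_mat (\<alpha> / \<beta>)"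
    and "sigma_mat \<alpha> ** tau_mat \<beta> = sigma_mat (\<alpha> / \<beta>)"
    and "tau_mat \<alpha> ** sigma_mat \<beta> = sigma_mat (\<alpha> * \<beta>)"
    and "tau_mat \<alpha> ** tau_mat \<beta> = tau_mat (\<alpha> * \<beta>)"
  using assms
  by (simp_all add: sigma_mat_def tau_mat_def matrix_matrix_mult_def vec_eq_iff forall_2 sum_2
      field_simps)

lemma tau_mat_1: "tau_mat (1::'a::field) = mat 1"
  by (simp add: tau_mat_def mat_def vec_eq_iff forall_2)

lemma O2plus_inverse:
  assumes "g \<in> (O2plus :: ('a::field ^ 2 ^ 2) set)"
  shows "\<exists>h\<in>O2plus. g ** h = mat 1 \<and> h ** g = mat 1"
proof -
  from assms consider \<alpha> where "\<alpha> \<noteq> 0" "g = sigma_mat \<alpha>" | \<alpha> where "\<alpha> \<noteq> 0" "g = tau_mat \<alpha>"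
    unfolding O2plus_def by blast
  then show ?thesis
  proof cases
    case 1
    then show ?thesis
      using assms by (intro bexI[of _ g]) (simp_all add: sigma_tau_mult tau_mat_1)
  next
    case 2
    then have "tau_mat (inverse \<alpha>) \<in> O2plus"
      unfolding O2plus_def by auto
    with 2 show ?thesis
      by (intro bexI[of _ "tau_mat (inverse \<alpha>)"]) (simp_all add: sigma_tau_mult tau_mat_1)
  qed
qed

lemma O2plus_subgroup:
  shows "mat 1 \<in> (O2plus :: ('a::field ^ 2 ^ 2) set)"
    and "g \<in> O2plus \<Longrightarrow> h \<in> O2plus \<Longrightarrow> g ** h \<in> (O2plus :: ('a ^ 2 ^ 2) set)"
    and "g \<in> O2plus \<Longrightarrow> invertible (g :: 'a ^ 2 ^ 2)"
    and "g \<in> O2plus \<Longrightarrow> matrix_inv g \<in> (O2plus :: ('a ^ 2 ^ 2) set)"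
proof -
  show "mat 1 \<in> (O2plus :: ('a ^ 2 ^ 2) set)"
    unfolding O2plus_def tau_mat_1[symmetric] using one_neq_zero by blast
  show "g ** h \<in> (O2plus :: ('a ^ 2 ^ 2) set)" if "g \<in> O2plus" "h \<in> O2plus"
  proof -
    have "sigma_mat x \<in> O2plus" "tau_mat x \<in> O2plus" if "x \<noteq> 0" for x :: 'a
      using that unfolding O2plus_def by blast+
    then show ?thesis
      using that by (auto simp: O2plus_def[THEN eqset_imp_iff] sigma_tau_mult)
  qed
  show inv: "invertible g" if "g \<in> O2plus" for g :: "'a ^ 2 ^ 2"
    using O2plus_inverse[OF that] unfolding invertible_def by blast
  show "matrix_inv g \<in> O2plus" if g: "g \<in> O2plus" for g :: "'a ^ 2 ^ 2"
  proof -
    obtain h where h: "h \<in> O2plus" "g ** h = mat 1"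
      using O2plus_inverse[OF g] by blast
    have "matrix_inv g ** g = mat 1"
      using someI_ex[OF inv[OF g, unfolded invertible_def]] unfolding matrix_inv_def by blast
    then have "matrix_inv g = h"
      using h(2) by (metis matrix_mul_assoc matrix_mul_lid matrix_mul_rid)
    with h(1) show ?thesis by simp
  qed
qed

end

theory Submission
  imports Defs
begin

text \<open>
  Over a finite field, the invariants of a finite group \<open>G\<close> separate its orbits: if \<open>f\<close> vanishes
  on a tuple exactly when it equals \<open>u\<close>, then the norm \<open>\<Prod>\<^sub>g g \<cdot> f\<close> is an invariant that vanishes
  exactly on the orbit of \<open>u\<close>. So the upper bound amounts to the following: if any two
  components of \<open>u\<close> can be moved simultaneously to those of \<open>v\<close>, then all of them can. This holds
  because every nonzero vector has a stabilizer of order at most two in \<open>O2plus\<close>, and because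
  two distinct \<open>\<sigma>\<^sub>\<alpha>\<close>, or two distinct \<open>\<tau>\<^sub>\<alpha>\<close>, never agree on a nonzero vector.

  For the lower bound, \<open>(e\<^sub>1, e\<^sub>1)\<close> and \<open>(e\<^sub>1, e\<^sub>2)\<close> are separated by
  \<open>x\<^sub>1\<^sub>1 x\<^sub>2\<^sub>2 + x\<^sub>1\<^sub>2 x\<^sub>2\<^sub>1\<close>, although \<open>e\<^sub>1\<close> and \<open>e\<^sub>2\<close> lie in one orbit.
\<close>

section \<open>Homomorphisms of polynomial rings\<close>

text \<open>Every polynomial is a finite sum of monomials, so identities additive in
  \<open>p\<close> need checking only on single terms; \<open>mpoly_hom_mult\<close> uses this in
  both factors.\<close>

lemma poly_mapping_induct [case_names zero single add]:
  assumes "P 0"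
    and "\<And>t a. P (Poly_Mapping.single t a)"
    and "\<And>p q. P p \<Longrightarrow> P q \<Longrightarrow> P (p + q)"
  shows "P (p :: 'k \<Rightarrow>\<^sub>0 'b::monoid_add)"
proof (induction p rule: update_induct)
  case const
  show ?case by fact
next
  case (update f a b)
  have "Poly_Mapping.update a b f = f + Poly_Mapping.single a b"
    using update(1)
    by (intro poly_mapping_eqI) (auto simp: lookup_add lookup_update lookup_single in_keys_iff when_def)
  with update assms show ?case by metis
qed

definition monom_eval :: "('v \<Rightarrow> 'b::comm_semiring_1) \<Rightarrow> ('v \<Rightarrow>\<^sub>0 nat) \<Rightarrow> 'b" where
  "monom_eval s t = (\<Prod>x\<in>Poly_Mapping.keys t. s x ^ Poly_Mapping.lookup t x)"

text \<open>Additional variables carry exponent 0 and contribute factors 1, so two monomials can be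
  compared over a common index set.\<close>

lemma monom_eval_superset:
  assumes "finite X" "Poly_Mapping.keys t \<subseteq> X"
  shows "monom_eval s t = (\<Prod>x\<in>X. s x ^ Poly_Mapping.lookup t x)"
  unfolding monom_eval_def using assms
  by (intro prod.mono_neutral_left) (auto simp: in_keys_iff)

lemma monom_eval_0: "monom_eval s 0 = 1"
  by (simp add: monom_eval_def)

lemma monom_eval_add: "monom_eval s (t + t') = monom_eval s t * monom_eval s t'"
proof -
  let ?X = "Poly_Mapping.keys t \<union> Poly_Mapping.keys t'"
  have "Poly_Mapping.keys (t + t') \<subseteq> ?X"
    by (rule keys_add)
  then show ?thesis
    by (simp add: monom_eval_superset[of ?X] lookup_add power_add prod.distrib)
qed

text \<open>The instances are \<open>id\<close>, for evaluation at a point, and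
  \<open>Const\<close>, for substitution, so both are shown multiplicative at once.\<close>

locale semiring_hom =
  fixes c :: "'a::comm_semiring_1 \<Rightarrow> 'b::comm_semiring_1"
  assumes hom_0: "c 0 = 0" and hom_1: "c 1 = 1"
    and hom_add: "c (x + y) = c x + c y" and hom_mult: "c (x * y) = c x * c y"
begin

lemma mpoly_hom_superset:
  assumes "finite T" "Poly_Mapping.keys p \<subseteq> T"
  shows "mpoly_hom c s p = (\<Sum>t\<in>T. c (Poly_Mapping.lookup p t) * monom_eval s t)"
  unfolding mpoly_hom_def monom_eval_def[symmetric] using assms
  by (intro sum.mono_neutral_left) (auto simp: in_keys_iff hom_0)

lemma mpoly_hom_0: "mpoly_hom c s 0 = 0"
  by (simp add: mpoly_hom_def)

lemma mpoly_hom_single: "mpoly_hom c s (Poly_Mapping.single t a) = c a * monom_eval s t"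
  by (simp add: mpoly_hom_superset[of "{t}"])

lemma mpoly_hom_1: "mpoly_hom c s 1 = 1"
  using mpoly_hom_single[of s 0 1] by (simp add: hom_1 monom_eval_0)

lemma mpoly_hom_add: "mpoly_hom c s (p + q) = mpoly_hom c s p + mpoly_hom c s q"
proof -
  let ?T = "Poly_Mapping.keys p \<union> Poly_Mapping.keys q"
  have "Poly_Mapping.keys (p + q) \<subseteq> ?T"
    by (rule keys_add)
  then show ?thesis
    by (simp add: mpoly_hom_superset[of ?T] lookup_add hom_add distrib_right sum.distrib)
qed

lemma mpoly_hom_mult: "mpoly_hom c s (p * q) = mpoly_hom c s p * mpoly_hom c s q"
proof (induction p rule: poly_mapping_induct)
  case (single t a)
  show ?case
  proof (induction q rule: poly_mapping_induct)
    case (single t' b)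
    show ?case
      by (simp add: mult_single mpoly_hom_single hom_mult monom_eval_add ac_simps)
  qed (simp_all add: mpoly_hom_0 mpoly_hom_add distrib_left)
qed (simp_all add: mpoly_hom_0 mpoly_hom_add distrib_right)

lemma mpoly_hom_power: "mpoly_hom c s (p ^ n) = mpoly_hom c s p ^ n"
  by (induction n) (simp_all add: mpoly_hom_1 mpoly_hom_mult)

lemma mpoly_hom_sum: "mpoly_hom c s (\<Sum>i\<in>I. p i) = (\<Sum>i\<in>I. mpoly_hom c s (p i))"
  by (induction I rule: infinite_finite_induct) (simp_all add: mpoly_hom_0 mpoly_hom_add)

lemma mpoly_hom_prod: "mpoly_hom c s (\<Prod>i\<in>I. p i) = (\<Prod>i\<in>I. mpoly_hom c s (p i))"
  by (induction I rule: infinite_finite_induct) (simp_all add: mpoly_hom_1 mpoly_hom_mult)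

text \<open>The outer map is a homomorphism that sends \<open>Const a\<close> to \<open>c a\<close>,
  so it can be pushed through the sum defining the substitution. For \<open>c = id\<close> this
  evaluates a substituted polynomial, for \<open>c = Const\<close> it composes
  substitutions.\<close>

lemma mpoly_hom_subst:
  "mpoly_hom c s (mpoly_subst s' p) = mpoly_hom c (\<lambda>x. mpoly_hom c s (s' x)) p"
  by (simp add: mpoly_subst_def mpoly_hom_def[of Const] mpoly_hom_sum mpoly_hom_mult
      mpoly_hom_prod mpoly_hom_power mpoly_hom_Const hom_0)
    (simp add: mpoly_hom_def)

lemmas mpoly_hom_simps = mpoly_hom_0 mpoly_hom_1 mpoly_hom_add mpoly_hom_mult mpoly_hom_sum
  mpoly_hom_prod mpoly_hom_Const[of c, OF hom_0] mpoly_hom_Var[of c, OF hom_1]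

end

lemma mpoly_hom_cong:
  assumes "\<And>x. x \<in> vars p \<Longrightarrow> s x = s' x"
  shows "mpoly_hom c s p = mpoly_hom c s' p"
proof -
  have "s x = s' x" if "t \<in> Poly_Mapping.keys p" "x \<in> Poly_Mapping.keys t" for t x
    using assms that by (auto simp: vars_def)
  then show ?thesis
    unfolding mpoly_hom_def
    by (intro sum.cong refl arg_cong2[where f = "(*)"] prod.cong) simp
qed

lemma Const_0: "Const 0 = 0"
  by (simp add: Const_def)

lemma Const_1: "Const 1 = 1"
  by (simp add: Const_def)

lemma Const_add: "Const (a + b) = Const a + Const b"
  by (simp add: Const_def single_add)

lemma Const_mult: "Const (a * b) = Const a * Const b"
  by (simp add: Const_def mult_single)

lemma Const_sum: "Const (\<Sum>i\<in>I. a i) = (\<Sum>i\<in>I. Const (a i))"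
  by (induction I rule: infinite_finite_induct) (simp_all add: Const_0 Const_add)

interpretation eval_hom: semiring_hom id
  by unfold_locales simp_all

interpretation subst_hom: semiring_hom Const
  by unfold_locales (simp_all add: Const_0 Const_1 Const_add Const_mult)

lemma mpoly_subst_subst:
  "mpoly_subst s (mpoly_subst s' p) = mpoly_subst (\<lambda>x. mpoly_subst s (s' x)) p"
  using subst_hom.mpoly_hom_subst by (simp add: mpoly_subst_def)

lemma mpoly_subst_cong:
  "(\<And>x. x \<in> vars p \<Longrightarrow> s x = s' x) \<Longrightarrow> mpoly_subst s p = mpoly_subst s' p"
  unfolding mpoly_subst_def by (rule mpoly_hom_cong)


section \<open>Coordinate rings and the group action\<close>

lemma coord_ring_add: "f \<in> coord_ring m \<Longrightarrow> h \<in> coord_ring m \<Longrightarrow> f + h \<in> coord_ring m"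
  using keys_add[of f h] unfolding coord_ring_def vars_def by blast

lemma coord_ring_mult:
  assumes "f \<in> coord_ring m" "h \<in> coord_ring m"
  shows "f * h \<in> coord_ring m"
proof -
  have "Poly_Mapping.keys t \<subseteq> {1..m} \<times> UNIV" if t: "t \<in> Poly_Mapping.keys (f * h)" for t
  proof -
    obtain a b where "t = a + b" "a \<in> Poly_Mapping.keys f" "b \<in> Poly_Mapping.keys h"
      using t keys_mult[of f h] by blast
    then show ?thesis
      using assms keys_add[of a b] unfolding coord_ring_def vars_def by blast
  qed
  then show ?thesis
    unfolding coord_ring_def vars_def by blast
qed

lemma coord_ring_Const: "Const a \<in> coord_ring m"
  by (simp add: coord_ring_def vars_def Const_def)

lemma coord_ring_Var: "i \<in> {1..m} \<Longrightarrow> Var (i, j) \<in> coord_ring m"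
  by (simp add: coord_ring_def vars_def Var_def)

lemma coord_ring_sum: "(\<And>i. i \<in> I \<Longrightarrow> f i \<in> coord_ring m) \<Longrightarrow> (\<Sum>i\<in>I. f i) \<in> coord_ring m"
  using coord_ring_Const[of 0]
  by (induction I rule: infinite_finite_induct) (auto simp: Const_0 intro: coord_ring_add)

lemma coord_ring_prod: "(\<And>i. i \<in> I \<Longrightarrow> f i \<in> coord_ring m) \<Longrightarrow> (\<Prod>i\<in>I. f i) \<in> coord_ring m"
  using coord_ring_Const[of 1]
  by (induction I rule: infinite_finite_induct) (auto simp: Const_1 intro: coord_ring_mult)

lemma coord_ring_power: "f \<in> coord_ring m \<Longrightarrow> f ^ n \<in> coord_ring m"
  using coord_ring_prod[of "{..<n}" "\<lambda>_. f" m] by simp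

lemma coord_ring_subst:
  assumes "\<And>x. x \<in> vars f \<Longrightarrow> s x \<in> coord_ring m"
  shows "mpoly_subst s f \<in> coord_ring m"
  unfolding mpoly_subst_def mpoly_hom_def using assms
  by (intro coord_ring_sum coord_ring_mult coord_ring_Const coord_ring_prod coord_ring_power)
    (auto simp: vars_def)

lemma vars_coord_ring: "f \<in> coord_ring m \<Longrightarrow> (i, j) \<in> vars f \<Longrightarrow> i \<in> {1..m}"
  unfolding coord_ring_def by blast

lemma coord_ring_poly_act: "f \<in> coord_ring m \<Longrightarrow> poly_act g f \<in> coord_ring m"
  unfolding poly_act_def
  by (intro coord_ring_subst)
    (auto simp only: split: prod.split dest: vars_coord_ring
      intro!: coord_ring_sum coord_ring_mult coord_ring_Const coord_ring_Var)

lemma eval_at_cong: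
  assumes "f \<in> coord_ring m" "\<And>i. i \<in> {1..m} \<Longrightarrow> u i = v i"
  shows "eval_at u f = eval_at v f"
  unfolding eval_at_def using assms by (intro mpoly_hom_cong) (auto simp: coord_ring_def)

lemma eval_at_prod: "eval_at v (\<Prod>i\<in>I. f i) = (\<Prod>i\<in>I. eval_at v (f i))"
  by (simp add: eval_at_def eval_hom.mpoly_hom_prod)

text \<open>Carries the formal action over to points: the rule prescribed on linear forms extends to
  all polynomials.\<close>

lemma eval_at_poly_act: "eval_at v (poly_act g f) = eval_at (\<lambda>i. matrix_inv g *v v i) f"
  unfolding eval_at_def poly_act_def eval_hom.mpoly_hom_subst
  by (intro mpoly_hom_cong)
    (auto simp: eval_hom.mpoly_hom_simps matrix_vector_mult_def)

lemma eval_at_reindex: "eval_at v (reindex \<iota> f) = eval_at (\<lambda>k. v (\<iota> k)) f"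
  unfolding eval_at_def reindex_def eval_hom.mpoly_hom_subst
  by (intro mpoly_hom_cong) (auto simp: eval_hom.mpoly_hom_simps)

text \<open>The action mixes only the second indices of the variables, and reindexing changes only
  the first.\<close>

lemma poly_act_reindex: "poly_act g (reindex \<iota> f) = reindex \<iota> (poly_act g f)"
  unfolding poly_act_def reindex_def mpoly_subst_subst
  by (intro mpoly_subst_cong) (auto simp: mpoly_subst_def subst_hom.mpoly_hom_simps)

lemma reindex_invariant:
  assumes "f \<in> invariants G n" "\<And>k. k \<in> {1..n} \<Longrightarrow> \<iota> k \<in> {1..m}"
  shows "reindex \<iota> f \<in> invariants G m"
proof -
  have "reindex \<iota> f \<in> coord_ring m"
    unfolding reindex_def using assms
    by (intro coord_ring_subst) (auto simp: invariants_def coord_ring_def[of n]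
        split: prod.split intro!: coord_ring_Var)
  then show ?thesis
    using assms by (simp add: invariants_def poly_act_reindex)
qed

lemma expansion_invariant:
  assumes "S \<subseteq> invariants G n"
  shows "expansion n m S \<subseteq> invariants G m"
proof
  fix f assume "f \<in> expansion n m S"
  then obtain \<iota> h where "f = reindex \<iota> h" "h \<in> S" "\<iota> \<in> {1..n} \<rightarrow>\<^sub>E {1..m}"
    unfolding expansion_def admissible_def by blast
  then show "f \<in> invariants G m"
    using assms by (auto intro!: reindex_invariant)
qed

section \<open>Inverse matrices and composition of the action\<close>

lemma matrix_inv:
  assumes "invertible A"
  shows "A ** matrix_inv A = mat 1" "matrix_inv A ** A = mat 1"
  using someI_ex[OF assms[unfolded invertible_def]] unfolding matrix_inv_def by blast+

lemma matrix_inv_mult: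
  fixes A B :: "'a::field ^ 'n ^ 'n"
  assumes "invertible A" "invertible B"
  shows "matrix_inv (A ** B) = matrix_inv B ** matrix_inv A"
proof -
  have "(matrix_inv B ** matrix_inv A) ** (A ** B) = mat 1"
    by (metis assms matrix_inv(2) matrix_mul_assoc matrix_mul_lid)
  moreover have "(A ** B) ** matrix_inv (A ** B) = mat 1"
    using assms by (simp add: invertible_mult matrix_inv)
  ultimately show ?thesis
    by (metis matrix_mul_assoc matrix_mul_lid matrix_mul_rid)
qed

text \<open>Inversion and substitution each reverse the order of factors, so a left action results.
  Substitutions are determined by the variables, which leaves a comparison of linear forms.\<close>

lemma poly_act_poly_act:
  fixes g h :: "'a::field ^ 'n ^ 'n"
  assumes "invertible g" "invertible h"
  shows "poly_act g (poly_act h f) = poly_act (g ** h) f"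
proof -
  have "(\<Sum>k\<in>UNIV. Const (matrix_inv h $ j $ k) * (\<Sum>l\<in>UNIV. Const (matrix_inv g $ k $ l) * Var (i, l)))
      = (\<Sum>l\<in>UNIV. Const (matrix_inv (g ** h) $ j $ l) * Var (i, l))" (is "?lhs = ?rhs") for i :: nat and j
  proof -
    have "?lhs = (\<Sum>k\<in>UNIV. \<Sum>l\<in>UNIV. Const (matrix_inv h $ j $ k * matrix_inv g $ k $ l) * Var (i, l))"
      by (simp add: sum_distrib_left Const_mult mult.assoc)
    also have "\<dots> = (\<Sum>l\<in>UNIV. \<Sum>k\<in>UNIV. Const (matrix_inv h $ j $ k * matrix_inv g $ k $ l) * Var (i, l))"
      by (rule sum.swap)
    also have "\<dots> = ?rhs"
      unfolding matrix_inv_mult[OF assms]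
      by (simp add: matrix_matrix_mult_def Const_sum sum_distrib_right)
    finally show ?thesis .
  qed
  then show ?thesis
    unfolding poly_act_def mpoly_subst_subst
    by (intro mpoly_subst_cong) (auto simp: mpoly_subst_def subst_hom.mpoly_hom_simps)
qed


section \<open>Orbit separation\<close>

locale matrix_group =
  fixes G :: "('a::field ^ 'n ^ 'n) set"
  assumes one_mem: "mat 1 \<in> G"
    and mult_mem: "g \<in> G \<Longrightarrow> h \<in> G \<Longrightarrow> g ** h \<in> G"
    and invertible: "g \<in> G \<Longrightarrow> invertible g"
    and inv_mem: "g \<in> G \<Longrightarrow> matrix_inv g \<in> G"
begin

lemma inv_act: "g \<in> G \<Longrightarrow> matrix_inv g *v x = y \<longleftrightarrow> x = g *v y"
  by (metis invertible matrix_inv matrix_vector_mul_assoc matrix_vector_mul_lid)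

text \<open>The easy direction, converse to \<open>invariants_separate_orbits\<close>: invariants
  are constant on orbits.\<close>

lemma eval_at_orbit:
  assumes "f \<in> invariants G m" "g \<in> G" "\<And>i. i \<in> {1..m} \<Longrightarrow> v i = g *v u i"
  shows "eval_at u f = eval_at v f"
proof -
  have "eval_at v f = eval_at v (poly_act g f)"
    using assms by (simp add: invariants_def)
  also have "\<dots> = eval_at (\<lambda>i. matrix_inv g *v v i) f"
    by (rule eval_at_poly_act)
  also have "\<dots> = eval_at u f"
    using assms by (intro eval_at_cong[of f m]) (auto simp: invariants_def inv_act)
  finally show ?thesis ..
qed

text \<open>Left multiplication by \<open>h\<close> permutes the factors. For infinite
  \<open>G\<close> the product is 1 by convention, which is invariant too.\<close>

lemma norm_invariant:
  assumes "f \<in> coord_ring m"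
  shows "(\<Prod>g\<in>G. poly_act g f) \<in> invariants G m"
proof -
  have "poly_act h (\<Prod>g\<in>G. poly_act g f) = (\<Prod>g\<in>G. poly_act g f)" if h: "h \<in> G" for h
  proof -
    have bij: "bij_betw (\<lambda>g. h ** g) G G"
    proof (rule bij_betw_byWitness[where f' = "\<lambda>g. matrix_inv h ** g"])
      show "(\<lambda>g. h ** g) ` G \<subseteq> G" "(\<lambda>g. matrix_inv h ** g) ` G \<subseteq> G"
        using h by (auto intro: mult_mem inv_mem)
    qed (simp_all add: matrix_mul_assoc matrix_inv[OF invertible[OF h]])
    have "poly_act h (\<Prod>g\<in>G. poly_act g f) = (\<Prod>g\<in>G. poly_act h (poly_act g f))"
      by (subst poly_act_def) (simp add: mpoly_subst_def subst_hom.mpoly_hom_prod poly_act_def[of h])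
    also have "\<dots> = (\<Prod>g\<in>G. poly_act (h ** g) f)"
      using h by (intro prod.cong) (simp_all add: poly_act_poly_act invertible)
    also have "\<dots> = (\<Prod>g\<in>G. poly_act g f)"
      by (rule prod.reindex_bij_betw[OF bij])
    finally show ?thesis .
  qed
  with assms show ?thesis
    by (simp add: invariants_def coord_ring_prod coord_ring_poly_act)
qed

end

lemma exists_poly_vanishing_only_at:
  fixes u :: "nat \<Rightarrow> 'a::{field,finite} ^ 'n"
  shows "\<exists>f\<in>coord_ring m. \<forall>w. eval_at w f = 0 \<longleftrightarrow> (\<forall>i\<in>{1..m}. w i = u i)"
proof -
  \<comment> \<open>Up to a nonzero scalar, \<open>h\<close> is the indicator of \<open>u\<close>: a
    coordinate different from that of \<open>u\<close> is one of the excluded values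
    \<open>a\<close> and kills a factor. Subtracting \<open>h\<close> from its value at
    \<open>u\<close> turns this into a polynomial vanishing only at \<open>u\<close>.\<close>
  define h where "h = (\<Prod>i\<in>{1..m}. \<Prod>j\<in>UNIV. \<Prod>a\<in>UNIV - {u i $ j}. Var (i, j) + Const (- a))"
  let ?f = "Const (eval_at u h) + Const (-1) * h"
  have h: "h \<in> coord_ring m"
    unfolding h_def by (intro coord_ring_prod coord_ring_add coord_ring_Var coord_ring_Const)
  have "eval_at w h = (\<Prod>i\<in>{1..m}. \<Prod>j\<in>UNIV. \<Prod>a\<in>UNIV - {u i $ j}. w i $ j - a)" for w
    by (simp add: h_def eval_at_def eval_hom.mpoly_hom_simps)
  then have eval_h: "eval_at w h = 0 \<longleftrightarrow> (\<exists>i\<in>{1..m}. w i \<noteq> u i)" for w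
    by (auto simp: vec_eq_iff)
  have eval_f: "eval_at w ?f = eval_at u h - eval_at w h" for w
    by (simp add: eval_at_def eval_hom.mpoly_hom_add eval_hom.mpoly_hom_mult mpoly_hom_Const)
  have "eval_at w ?f = 0 \<longleftrightarrow> (\<forall>i\<in>{1..m}. w i = u i)" for w
    unfolding eval_f using eval_h[of u] eval_h[of w] eval_at_cong[OF h, of w u] by auto
  moreover have "?f \<in> coord_ring m"
    by (intro coord_ring_add coord_ring_mult coord_ring_Const h)
  ultimately show ?thesis
    by blast
qed

lemma invariants_separate_orbits:
  fixes G :: "('a::{field,finite} ^ 'n ^ 'n) set"
  assumes "matrix_group G" and agree: "\<And>f. f \<in> invariants G m \<Longrightarrow> eval_at u f = eval_at v f"
  shows "\<exists>g\<in>G. \<forall>i\<in>{1..m}. v i = g *v u i"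
proof -
  interpret matrix_group G by fact
  obtain f where f: "f \<in> coord_ring m"
    "\<And>w. eval_at w f = 0 \<longleftrightarrow> (\<forall>i\<in>{1..m}. w i = u i)"
    using exists_poly_vanishing_only_at[of m u] by blast
  \<comment> \<open>A product in a field vanishes iff some factor does, and the factor of
    \<open>g\<close> vanishes exactly at the translate of \<open>u\<close> by \<open>g\<close>;
    finiteness of \<open>G\<close> comes from the finite field.\<close>
  have norm_eq_0: "eval_at w (\<Prod>g\<in>G. poly_act g f) = 0 \<longleftrightarrow> (\<exists>g\<in>G. \<forall>i\<in>{1..m}. w i = g *v u i)" for w
    by (auto simp: eval_at_prod eval_at_poly_act f(2) inv_act)
  have "eval_at u (\<Prod>g\<in>G. poly_act g f) = 0"
    unfolding norm_eq_0 using one_mem by (intro bexI[of _ "mat 1"]) simp_all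
  then have "eval_at v (\<Prod>g\<in>G. poly_act g f) = 0"
    by (simp add: agree norm_invariant f(1))
  then show ?thesis
    unfolding norm_eq_0 .
qed

section \<open>Reduction to pairs of components\<close>

lemma eval_at_reindex_pair:
  assumes f: "f \<in> invariants G 2" and ij: "i \<in> {1..m}" "j \<in> {1..m}" "i < j"
  shows "\<exists>\<iota>\<in>admissible 2 m. \<forall>w. eval_at w (reindex \<iota> f) = eval_at (\<lambda>k. if k = 1 then w i else w j) f"
proof
  let ?\<iota> = "\<lambda>k\<in>{1..2}. if k = 1 then i else j"
  show "?\<iota> \<in> admissible 2 m"
    using ij by (auto simp: admissible_def strict_mono_on_def)
  \<comment> \<open>The two tuples may differ outside the indices 1 and 2, but \<open>f\<close> has
    no variables there.\<close>
  show "\<forall>w. eval_at w (reindex ?\<iota> f) = eval_at (\<lambda>k. if k = 1 then w i else w j) f"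
    using f by (auto simp: eval_at_reindex invariants_def intro!: eval_at_cong)
qed

text \<open>If the expansion fails to separate \<open>u\<close> and \<open>v\<close>, orbit
  separation for two vectors matches every pair of components; by the hypothesis
  \<open>pairs\<close> the whole tuples then share an orbit, so no invariant separates them.\<close>

lemma separating_expansion_pairs:
  fixes G :: "('a::{field,finite} ^ 'n ^ 'n) set"
  assumes "matrix_group G" and "m \<ge> 2"
    and pairs: "\<And>u v. (\<And>i j. i \<in> {1..m} \<Longrightarrow> j \<in> {1..m} \<Longrightarrow> \<exists>g\<in>G. v i = g *v u i \<and> v j = g *v u j)
      \<Longrightarrow> \<exists>g\<in>G. \<forall>i\<in>{1..m}. v i = g *v u i"
  shows "separating G m (expansion 2 m (invariants G 2))"
  unfolding separating_def
proof (intro conjI ballI impI expansion_invariant order_refl)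
  interpret matrix_group G by fact
  fix u v :: "nat \<Rightarrow> 'a ^ 'n"
  assume sep: "separated_by (invariants G m) u v"
  show "separated_by (expansion 2 m (invariants G 2)) u v"
  proof (rule ccontr)
    assume not_sep: "\<not> separated_by (expansion 2 m (invariants G 2)) u v"
    have less: "\<exists>g\<in>G. v i = g *v u i \<and> v j = g *v u j"
      if ij: "i \<in> {1..m}" "j \<in> {1..m}" "i < j" for i j
    proof -
      have "\<exists>g\<in>G. \<forall>k\<in>{1..2::nat}. (if k = 1 then v i else v j) = g *v (if k = 1 then u i else u j)"
      proof (rule invariants_separate_orbits)
        fix f assume f: "f \<in> invariants G 2"
        then obtain \<iota> where \<iota>: "\<iota> \<in> admissible 2 m"
          "\<And>w. eval_at w (reindex \<iota> f) = eval_at (\<lambda>k. if k = 1 then w i else w j) f"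
          using eval_at_reindex_pair[OF f ij] by blast
        have "reindex \<iota> f \<in> expansion 2 m (invariants G 2)"
          using f \<iota>(1) unfolding expansion_def by blast
        then have "eval_at u (reindex \<iota> f) = eval_at v (reindex \<iota> f)"
          using not_sep unfolding separated_by_def by blast
        then show "eval_at (\<lambda>k. if k = 1 then u i else u j) f
            = eval_at (\<lambda>k. if k = 1 then v i else v j) f"
          by (simp add: \<iota>(2))
      qed fact
      then show ?thesis
        by (force dest: bspec[of _ _ 1] bspec[of _ _ 2])
    qed
    have "\<exists>g\<in>G. \<forall>i\<in>{1..m}. v i = g *v u i"
    proof (rule pairs)
      fix i j assume "i \<in> {1..m}" "j \<in> {1..m}"
      \<comment> \<open>Admissible tuples increase strictly, so a diagonal pair needs a partner:
        \<open>m\<close>, or 1 when the index is \<open>m\<close> itself. This is where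
        \<open>m \<ge> 2\<close> enters.\<close>
      then consider "i < j" | "j < i" | "i = j" "i < m" | "i = j" "i = m"
        by fastforce
      then show "\<exists>g\<in>G. v i = g *v u i \<and> v j = g *v u j"
      proof cases
        case 3
        then show ?thesis
          using less[of i m] \<open>i \<in> {1..m}\<close> by auto
      next
        case 4
        then show ?thesis
          using less[of 1 i] \<open>m \<ge> 2\<close> by auto
      qed (use less \<open>i \<in> _\<close> \<open>j \<in> _\<close> in blast)+
    qed
    then obtain g where "g \<in> G" "\<And>i. i \<in> {1..m} \<Longrightarrow> v i = g *v u i"
      by blast
    then have "eval_at u f = eval_at v f" if "f \<in> invariants G m" for f
      using eval_at_orbit that by blast
    with sep show False
      unfolding separated_by_def by blast
  qed
qed


section \<open>The orthogonal group of plus type\<close>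

interpretation O2plus: matrix_group "O2plus :: ('a::field ^ 2 ^ 2) set"
  by unfold_locales (rule O2plus_subgroup; assumption)+

lemma sigma_mat_mult_vec: "sigma_mat \<alpha> *v x = vector [\<alpha> * x $ 2, inverse \<alpha> * x $ 1]"
  by (simp add: vec_eq_iff forall_2 sigma_mat_def matrix_vector_mult_def sum_2)

lemma tau_mat_mult_vec: "tau_mat \<alpha> *v x = vector [\<alpha> * x $ 1, inverse \<alpha> * x $ 2]"
  by (simp add: vec_eq_iff forall_2 tau_mat_def matrix_vector_mult_def sum_2)

text \<open>A nonzero coordinate of \<open>x\<close> determines \<alpha>, directly or through its
  inverse.\<close>

lemma sigma_mat_eq:
  "sigma_mat \<alpha> *v x = sigma_mat \<beta> *v x \<Longrightarrow> x \<noteq> 0 \<Longrightarrow> \<alpha> = \<beta>"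
  by (auto simp: sigma_mat_mult_vec vec_eq_iff forall_2)

lemma tau_mat_fix: "tau_mat \<alpha> *v x = x \<Longrightarrow> x \<noteq> 0 \<Longrightarrow> \<alpha> = 1"
  by (auto simp: tau_mat_mult_vec vec_eq_iff forall_2)

lemma O2plus_cases:
  assumes "g \<in> O2plus"
  obtains \<alpha> where "\<alpha> \<noteq> 0" "g = sigma_mat \<alpha>" | \<alpha> where "\<alpha> \<noteq> 0" "g = tau_mat \<alpha>"
  using assms unfolding O2plus_def by blast

text \<open>Together with \<open>sigma_mat_eq\<close>, this bounds the stabilizer of a nonzero
  vector: the identity and at most one \<open>sigma_mat \<alpha>\<close>.\<close>

lemma O2plus_fix_cases:
  assumes "g \<in> O2plus" "g *v x = x" "x \<noteq> 0"
  obtains \<alpha> where "\<alpha> \<noteq> 0" "g = sigma_mat \<alpha>" | "g = mat 1"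
  using assms tau_mat_fix tau_mat_1 by (metis O2plus_cases)

text \<open>The normalized case, with a nonzero component already in place. Any component that moves
  forces the one nontrivial element \<open>s\<close> of the stabilizer of \<open>u i\<close>;
  comparing \<open>i\<close>, \<open>j\<close> and \<open>k\<close> pairwise shows that
  \<open>s\<close> works for every \<open>k\<close>.\<close>

lemma O2plus_pairs_fixed:
  fixes u v :: "'i \<Rightarrow> 'a::field ^ 2"
  assumes pairs: "\<And>i j. i \<in> I \<Longrightarrow> j \<in> I \<Longrightarrow> \<exists>g\<in>O2plus. v i = g *v u i \<and> v j = g *v u j"
    and i: "i \<in> I" "v i = u i" "u i \<noteq> 0"
  shows "\<exists>g\<in>O2plus. \<forall>j\<in>I. v j = g *v u j"
proof (cases "\<forall>j\<in>I. v j = u j")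
  case True
  then show ?thesis
    using O2plus.one_mem by (intro bexI[of _ "mat 1"]) auto
next
  case False
  then obtain j where j: "j \<in> I" "v j \<noteq> u j"
    by blast
  obtain s where s: "s \<in> O2plus" "s *v u i = u i" "v j = s *v u j"
    using pairs[OF i(1) j(1)] i(2) by metis
  then obtain \<alpha> where \<alpha>: "\<alpha> \<noteq> 0" "s = sigma_mat \<alpha>"
    using O2plus_fix_cases[of s "u i"] i(3) j(2) by (metis matrix_vector_mul_lid)
  have uj: "u j \<noteq> 0"
    using s(3) j(2) by auto
  have "v k = s *v u k" if k: "k \<in> I" for k
  proof (rule ccontr)
    assume vk: "v k \<noteq> s *v u k"
    obtain t where t: "t \<in> O2plus" "t *v u i = u i" "v k = t *v u k"
      using pairs[OF i(1) k] i(2) by metis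
    \<comment> \<open>The only other candidate in the stabilizer of \<open>u i\<close> is
      \<open>s\<close>, which is excluded by the choice of \<open>k\<close>.\<close>
    have "t = mat 1"
      using t(1,2) i(3)
    proof (cases rule: O2plus_fix_cases)
      case (1 \<beta>)
      then have "\<beta> = \<alpha>"
        using sigma_mat_eq[of \<beta> "u i" \<alpha>] s(2) t(2) \<alpha>(2) i(3) by simp
      then show ?thesis
        using 1 \<alpha>(2) t(3) vk by simp
    qed
    then have vk': "v k = u k"
      using t(3) by simp
    then have uk: "u k \<noteq> 0"
      using vk by auto
    \<comment> \<open>The contradiction comes from the pair \<open>j\<close>, \<open>k\<close>:
      \<open>g\<close> fixes \<open>u k\<close>, so it is the identity, although \<open>u j\<close>
      moves, or some \<open>sigma_mat \<beta>\<close>, which agrees with \<open>s\<close> on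
      \<open>u j\<close> and so equals \<open>s\<close>.\<close>
    obtain g where g: "g \<in> O2plus" "v j = g *v u j" "v k = g *v u k"
      using pairs[OF j(1) k] by blast
    have "g *v u k = u k"
      using g(3) vk' by simp
    from g(1) this uk show False
    proof (cases rule: O2plus_fix_cases)
      case (1 \<beta>)
      then have "\<beta> = \<alpha>"
        using sigma_mat_eq[of \<beta> "u j" \<alpha>] g(2) s(3) \<alpha>(2) uj by simp
      then show False
        using 1 \<alpha>(2) g(3) vk by simp
    next
      case 2
      then show False
        using g(2) j(2) by simp
    qed
  qed
  with s(1) show ?thesis
    by blast
qed

lemma O2plus_pairs:
  fixes u v :: "'i \<Rightarrow> 'a::field ^ 2"
  assumes pairs: "\<And>i j. i \<in> I \<Longrightarrow> j \<in> I \<Longrightarrow> \<exists>g\<in>O2plus. v i = g *v u i \<and> v j = g *v u j"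
  shows "\<exists>g\<in>O2plus. \<forall>i\<in>I. v i = g *v u i"
proof (cases "\<forall>i\<in>I. u i = 0")
  case True
  have "v i = 0" if "i \<in> I" for i
    using pairs[OF that that] True that by auto
  with True show ?thesis
    using O2plus.one_mem by (intro bexI[of _ "mat 1"]) auto
next
  case False
  then obtain i where i: "i \<in> I" "u i \<noteq> 0"
    by blast
  obtain h where h: "h \<in> O2plus" "v i = h *v u i"
    using pairs[OF i(1) i(1)] by blast
  \<comment> \<open>Translating \<open>v\<close> by the inverse of \<open>h\<close> makes component
    \<open>i\<close> equal to \<open>u i\<close>, the normalized case; \<open>h\<close> is
    multiplied back afterwards.\<close>
  have "\<exists>g\<in>O2plus. \<forall>j\<in>I. matrix_inv h *v v j = g *v u j"
  proof (rule O2plus_pairs_fixed)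
    fix j k assume "j \<in> I" "k \<in> I"
    then obtain g where "g \<in> O2plus" "v j = g *v u j" "v k = g *v u k"
      using pairs by blast
    then show "\<exists>g\<in>O2plus. matrix_inv h *v v j = g *v u j \<and> matrix_inv h *v v k = g *v u k"
      using h(1)
      by (intro bexI[of _ "matrix_inv h ** g"])
        (auto simp: matrix_vector_mul_assoc intro: O2plus.mult_mem O2plus.inv_mem)
  qed (use i h in \<open>auto simp: O2plus.inv_act\<close>)
  then obtain g where "g \<in> O2plus" "\<And>j. j \<in> I \<Longrightarrow> matrix_inv h *v v j = g *v u j"
    by blast
  then show ?thesis
    using h(1)
    by (intro bexI[of _ "h ** g"])
      (auto simp: O2plus.inv_act matrix_vector_mul_assoc[symmetric] intro: O2plus.mult_mem)
qed

section \<open>The lower bound, from the polar form of the quadratic form with value xy at (x,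
  y)\<close>

lemma polarization_invariant:
  "Var (1, 1) * Var (2, 2) + Var (1, 2) * Var (2, 1) \<in> invariants (O2plus :: ('a::field ^ 2 ^ 2) set) 2"
  (is "?f \<in> _")
proof -
  have "poly_act g ?f = ?f" if g: "g \<in> O2plus" for g :: "'a ^ 2 ^ 2"
  proof -
    have act: "poly_act g ?f = poly_act g (Var (1, 1)) * poly_act g (Var (2, 2))
        + poly_act g (Var (1, 2)) * poly_act g (Var (2, 1))"
      by (simp add: poly_act_def mpoly_subst_def subst_hom.mpoly_hom_add subst_hom.mpoly_hom_mult)
    have Const_inverse: "Const a * p * (Const (inverse a) * r) = p * r"
      "Const (inverse a) * p * (Const a * r) = p * r"
      if "a \<noteq> 0" for a :: 'a and p r :: "(nat \<times> 2, 'a) mpoly"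
    proof -
      have "Const a * Const (inverse a) = (1 :: (nat \<times> 2, 'a) mpoly)"
        using that by (simp add: Const_mult[symmetric] Const_1)
      moreover have "Const a * p * (Const (inverse a) * r) = (Const a * Const (inverse a)) * (p * r)"
        "Const (inverse a) * p * (Const a * r) = (Const a * Const (inverse a)) * (p * r)"
        by (simp_all only: ac_simps)
      ultimately show "Const a * p * (Const (inverse a) * r) = p * r"
        "Const (inverse a) * p * (Const a * r) = p * r"
        by simp_all
    qed
    \<comment> \<open>The action is written with the entries of \<open>matrix_inv g\<close>, so the
      cases concern the inverse. A \<sigma> exchanges the two summands, a \<tau> fixes each; the
      scalars cancel.\<close>
    from O2plus.inv_mem[OF g] show ?thesis
    proof (cases rule: O2plus_cases)
      case (1 \<alpha>)
      then show ?thesis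
        unfolding act poly_act_Var
        by (simp add: sum_2 sigma_mat_def Const_0 Const_inverse add.commute)
    next
      case (2 \<alpha>)
      then show ?thesis
        unfolding act poly_act_Var
        by (simp add: sum_2 tau_mat_def Const_0 Const_inverse)
    qed
  qed
  moreover have "?f \<in> coord_ring 2"
    by (intro coord_ring_add coord_ring_mult coord_ring_Var) simp_all
  ultimately show ?thesis
    by (simp add: invariants_def)
qed

text \<open>A reindexed invariant of one vector sees a single component, and in either position the
  components of \<open>u\<close> and \<open>v\<close> share an orbit. The polar form takes the
  values 0 at \<open>u\<close> and 1 at \<open>v\<close>.\<close>

lemma O2plus_expansion_1_not_separating:
  assumes S: "S \<subseteq> invariants (O2plus :: ('a::field ^ 2 ^ 2) set) 1"
  shows "\<not> separating (O2plus :: ('a ^ 2 ^ 2) set) 2 (expansion 1 2 S)"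
proof
  assume sep: "separating (O2plus :: ('a ^ 2 ^ 2) set) 2 (expansion 1 2 S)"
  define e :: "2 \<Rightarrow> 'a ^ 2" where "e j = axis j 1" for j
  define u where "u = (\<lambda>i\<in>{1..2::nat}. e 1)"
  define v where "v = (\<lambda>i\<in>{1..2::nat}. if i = 1 then e 1 else e 2)"
  have swap: "e 2 = sigma_mat 1 *v e 1"
    by (simp add: e_def sigma_mat_mult_vec vec_eq_iff forall_2 axis_def)
  have sigma_1: "sigma_mat 1 \<in> (O2plus :: ('a ^ 2 ^ 2) set)"
    unfolding O2plus_def using one_neq_zero by blast
  have "separated_by (invariants (O2plus :: ('a ^ 2 ^ 2) set) 2) u v"
    unfolding separated_by_def
    by (rule bexI[OF _ polarization_invariant])
      (simp add: eval_at_def eval_hom.mpoly_hom_simps u_def v_def e_def axis_def)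
  then have "separated_by (expansion 1 2 S) u v"
    using sep unfolding separating_def by (auto simp: vec_tuples_def u_def v_def)
  then obtain \<iota> f where "f \<in> S" "\<iota> \<in> admissible 1 2"
    and ne: "eval_at u (reindex \<iota> f) \<noteq> eval_at v (reindex \<iota> f)"
    unfolding separated_by_def expansion_def by blast
  then have f: "f \<in> invariants O2plus 1" and \<iota>: "\<iota> 1 \<in> {1..2}"
    using S by (auto simp: admissible_def)
  have "\<exists>g\<in>O2plus. v (\<iota> 1) = g *v u (\<iota> 1)"
  proof (cases "\<iota> 1 = 1")
    case True
    then show ?thesis
      using O2plus.one_mem by (intro bexI[of _ "mat 1"]) (auto simp: u_def v_def)
  next
    case False
    then show ?thesis
      using \<iota> swap sigma_1 by (intro bexI[of _ "sigma_mat 1"]) (auto simp: u_def v_def)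
  qed
  then obtain g where "g \<in> O2plus" "v (\<iota> 1) = g *v u (\<iota> 1)"
    by blast
  then have "eval_at (\<lambda>k. u (\<iota> k)) f = eval_at (\<lambda>k. v (\<iota> k)) f"
    by (intro O2plus.eval_at_orbit[OF f, of g]) auto
  with ne show False
    by (simp add: eval_at_reindex)
qed

theorem corollary4p2:
  fixes q :: nat
  assumes "primepow q"
    and "CARD('a::{field,finite}) = q"
  shows "sigma_sep (O2plus :: ('a ^ 2 ^ 2) set) = 2"
  unfolding sigma_sep_def
proof (rule Least_equality)
  let ?G = "O2plus :: ('a ^ 2 ^ 2) set"
  \<comment> \<open>The witness for \<open>S\<close> is the set of all invariants of two
    vectors.\<close>
  have "separating ?G 2 (invariants ?G 2)"
    by (simp add: separating_def)
  moreover have "separating ?G m (expansion 2 m (invariants ?G 2))" if "m \<ge> 2" for m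
    using O2plus.matrix_group_axioms that O2plus_pairs by (rule separating_expansion_pairs)
  ultimately show "2 \<ge> (1::nat) \<and>
      (\<exists>S. separating ?G 2 S \<and> (\<forall>m\<ge>2. separating ?G m (expansion 2 m S)))"
    by auto
next
  fix m\<^sub>0 :: nat
  assume *: "m\<^sub>0 \<ge> 1 \<and> (\<exists>S. separating (O2plus :: ('a ^ 2 ^ 2) set) m\<^sub>0 S \<and>
      (\<forall>m\<ge>m\<^sub>0. separating (O2plus :: ('a ^ 2 ^ 2) set) m (expansion m\<^sub>0 m S)))"
  have "m\<^sub>0 \<noteq> 1"
  proof
    assume "m\<^sub>0 = 1"
    with * obtain S where "separating (O2plus :: ('a ^ 2 ^ 2) set) 1 S"
      "separating (O2plus :: ('a ^ 2 ^ 2) set) 2 (expansion 1 2 S)"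
      using one_le_numeral by blast
    then show False
      using O2plus_expansion_1_not_separating unfolding separating_def[of _ 1] by blast
  qed
  with * show "2 \<le> m\<^sub>0"
    by linarith
qed

end
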